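(* Let $\mathbf{S}=(\mathbf{S}_{p,c})_{p\in P,\,c\in C^{\mathrm{MTS}}}$ with $\mathbf{S}_{p,c}=(S_{p,c,t})_{t\in T}$ be any fixed feasible (in particular componentwise nonnegative) aggregate make-to-stock supply profile. Let $Z^{\mathrm{LP}}_{\mathrm{MTS}}(\mathbf{S})$ be the minimum cost of the joint downstream make-to-stock linear program, and for each pair $(p,c)$ let $Z^{\mathrm{LP}}_{p,c}(\mathbf{S}_{p,c})$ be the minimum cost of the chain linear program of that pair. Then $$Z^{\mathrm{LP}}_{\mathrm{MTS}}(\mathbf{S})=\sum_{p\in P}\sum_{c\in C^{\mathrm{MTS}}} Z^{\mathrm{LP}}_{p,c}(\mathbf{S}_{p,c}).$$
   Context: $P$ (products), $C^{\mathrm{MTS}}$ (make-to-stock customers), $N$ (penalty segments) are finite sets and $T=\{1,\dots,|T|\}$ is the finite set of periods. Data: demands $d_{p,c,t}\ge 0$, initial inventories $I^{\mathrm{init}}_{p,c}\ge 0$, safety-stock targets $ss_{p,c,t}\ge 0$, lost-sales costs $\mathrm{cost}^{\mathrm{lost}}_{p,c}\ge 0$, and real penalty coefficients $\alpha_{p,c,t,i},\beta_{p,c,t,i}$ for $i\in N$. $S_{p,c,t}$ is the total quantity of product $p$ shipped to customer $c$ in period $t$; a supply profile is a nonnegative vector. Chain LP of the pair $(p,c)$ at $\mathbf{S}_{p,c}$: $Z^{\mathrm{LP}}_{p,c}(\mathbf{S}_{p,c})$ is the minimum of $\sum_{t\in T}(\mathrm{cost}^{\mathrm{lost}}_{p,c}\,l_{p,c,t}+\psi_{p,c,t})$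 over real variables $I^+_{p,c,t}, l_{p,c,t}, I^-_{p,c,t},\psi_{p,c,t}$ ($t\in T$) subject to - $I^+_{p,c,1}-l_{p,c,1}=I^{\mathrm{init}}_{p,c}+S_{p,c,1}-d_{p,c,1}$; - $I^+_{p,c,t}-I^+_{p,c,t-1}-l_{p,c,t}=S_{p,c,t}-d_{p,c,t}$ for $t>1$; - $I^-_{p,c,t}+I^+_{p,c,t}\ge ss_{p,c,t}$ for $t\in T$; - $\psi_{p,c,t}\ge \alpha_{p,c,t,i}I^-_{p,c,t}-\beta_{p,c,t,i}$ for $t\in T$, $i\in N$; - $0\le l_{p,c,t}\le d_{p,c,t}$ and $I^+_{p,c,t},I^-_{p,c,t},\psi_{p,c,t}\ge 0$ for $t\in T$. Joint downstream make-to-stock LP at $\mathbf{S}$: $Z^{\mathrm{LP}}_{\mathrm{MTS}}(\mathbf{S})$ is the minimum of $\sum_{p\in P}\sum_{c\in C^{\mathrm{MTS}}}\sum_{t\in T}(\mathrm{cost}^{\mathrm{lost}}_{p,c}\,l_{p,c,t}+\psi_{p,c,t})$ over all the real variables $(I^+_{p,c,t}, l_{p,c,t}, I^-_{p,c,t},\psi_{p,c,t})_{p\in P,c\in C^{\mathrm{MTS}},t\in T}$ satisfying, for every $(p,c)\in P\times C^{\mathrm{MTS}}$ simultaneously, - $I^+_{p,c,1}-l_{p,c,1}=I^{\mathrm{init}}_{p,c}+S_{p,c,1}-d_{p,c,1}$; - $I^+_{p,c,t}-I^+_{p,c,t-1}-l_{p,c,t}=S_{p,c,t}-d_{p,c,t}$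 for $t>1$; - $I^-_{p,c,t}+I^+_{p,c,t}\ge ss_{p,c,t}$ for $t\in T$; - $\psi_{p,c,t}\ge \alpha_{p,c,t,i}I^-_{p,c,t}-\beta_{p,c,t,i}$ for $t\in T$, $i\in N$; - $0\le l_{p,c,t}\le d_{p,c,t}$ and $I^+_{p,c,t},I^-_{p,c,t},\psi_{p,c,t}\ge 0$ for $t\in T$. *)

theory Defs
  imports Complex_Main
begin

record ('p, 'c, 'i) mts_data =
  products :: "'p set"
  customers :: "'c set"
  segments :: "'i set"
  horizon :: nat
  demand :: "'p \<Rightarrow> 'c \<Rightarrow> nat \<Rightarrow> real"
  init_inv :: "'p \<Rightarrow> 'c \<Rightarrow> real"
  safety_stock :: "'p \<Rightarrow> 'c \<Rightarrow> nat \<Rightarrow> real"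
  lost_cost :: "'p \<Rightarrow> 'c \<Rightarrow> real"
  pen_slope :: "'p \<Rightarrow> 'c \<Rightarrow> nat \<Rightarrow> 'i \<Rightarrow> real"
  pen_offset :: "'p \<Rightarrow> 'c \<Rightarrow> nat \<Rightarrow> 'i \<Rightarrow> real"

definition periods :: "('p, 'c, 'i) mts_data \<Rightarrow> nat set" where
  "periods D = {1..horizon D}"

text \<open>
  The variables \<open>Ipos\<close>, \<open>l\<close>, \<open>Ineg\<close>, \<open>psi\<close> (inventory, lost sales, safety-stock shortfall, penalty)
  are total functions, but only their values on \<^term>\<open>periods D\<close> occur in the constraints and
  in the objective.
\<close>

definition chain_feasible ::
  "('p, 'c, 'i) mts_data \<Rightarrow> 'p \<Rightarrow> 'c \<Rightarrow> (nat \<Rightarrow> real) \<Rightarrow>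
    (nat \<Rightarrow> real) \<Rightarrow> (nat \<Rightarrow> real) \<Rightarrow> (nat \<Rightarrow> real) \<Rightarrow> (nat \<Rightarrow> real) \<Rightarrow> bool" where
  "chain_feasible D p c S Ipos l Ineg psi \<longleftrightarrow>
    (1 \<in> periods D \<longrightarrow> Ipos 1 - l 1 = init_inv D p c + S 1 - demand D p c 1) \<and>
    (\<forall>t\<in>periods D. t > 1 \<longrightarrow> Ipos t - Ipos (t - 1) - l t = S t - demand D p c t) \<and>
    (\<forall>t\<in>periods D. Ineg t + Ipos t \<ge> safety_stock D p c t) \<and>
    (\<forall>t\<in>periods D. \<forall>i\<in>segments D.
        psi t \<ge> pen_slope D p c t i * Ineg t - pen_offset D p c t i) \<and>
    (\<forall>t\<in>periods D. 0 \<le> l t \<and> l t \<le> demand D p c t) \<and>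
    (\<forall>t\<in>periods D. Ipos t \<ge> 0 \<and> Ineg t \<ge> 0 \<and> psi t \<ge> 0)"

text \<open>
  On the reals, \<open>LEAST\<close> denotes the least element of a set of attained objective values, that
  is, a minimum in the proper sense rather than an infimum.
\<close>

definition Z_chain ::
  "('p, 'c, 'i) mts_data \<Rightarrow> 'p \<Rightarrow> 'c \<Rightarrow> (nat \<Rightarrow> real) \<Rightarrow> real" where
  "Z_chain D p c S =
    (LEAST z. \<exists>Ipos l Ineg psi. chain_feasible D p c S Ipos l Ineg psi \<and>
       z = (\<Sum>t\<in>periods D. lost_cost D p c * l t + psi t))"

definition joint_feasible ::
  "('p, 'c, 'i) mts_data \<Rightarrow> ('p \<Rightarrow> 'c \<Rightarrow> nat \<Rightarrow> real) \<Rightarrow>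
    ('p \<Rightarrow> 'c \<Rightarrow> nat \<Rightarrow> real) \<Rightarrow> ('p \<Rightarrow> 'c \<Rightarrow> nat \<Rightarrow> real) \<Rightarrow>
    ('p \<Rightarrow> 'c \<Rightarrow> nat \<Rightarrow> real) \<Rightarrow> ('p \<Rightarrow> 'c \<Rightarrow> nat \<Rightarrow> real) \<Rightarrow> bool" where
  "joint_feasible D S Ipos l Ineg psi \<longleftrightarrow>
    (\<forall>p\<in>products D. \<forall>c\<in>customers D.
       chain_feasible D p c (S p c) (Ipos p c) (l p c) (Ineg p c) (psi p c))"

definition Z_MTS ::
  "('p, 'c, 'i) mts_data \<Rightarrow> ('p \<Rightarrow> 'c \<Rightarrow> nat \<Rightarrow> real) \<Rightarrow> real" where
  "Z_MTS D S =
    (LEAST z. \<exists>Ipos l Ineg psi. joint_feasible D S Ipos l Ineg psi \<and>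
       z = (\<Sum>p\<in>products D. \<Sum>c\<in>customers D. \<Sum>t\<in>periods D.
              lost_cost D p c * l p c t + psi p c t))"

end

theory Submission
  imports Defs "HOL-Analysis.Function_Topology"
begin

text \<open>
  The joint program is a disjoint union of the chain programs, so its minimum is the sum of theirs,
  provided every chain minimum is attained. A chain is feasible because losing exactly the
  unserved demand is allowed. For attainment, the inventory is bounded by the cumulated supply, and
  shortfall and penalty can be truncated at suitable constants without losing feasibility or
  increasing the cost (also for negative slopes, where large shortfalls make the penalty bound
  vacuous); this leaves a continuous objective on a compact set.
\<close>

section \<open>Compact boxes of functions and truncation of penalties\<close>

lemma compact_function_box:
  fixes A B :: "'a \<Rightarrow> real"
  shows "compact {f. \<forall>t. f t \<in> {A t..B t}}"
proof -
  have "{f. \<forall>t. f t \<in> {A t..B t}} = PiE UNIV (\<lambda>t. {A t..B t})"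
    by (auto simp: PiE_def Pi_def)
  \<comment> \<open>Tychonoff's theorem; the topology of the function type is the product
    topology.\<close>
  moreover have "compactin (product_topology (\<lambda>_. euclidean) UNIV) (PiE UNIV (\<lambda>t. {A t..B t}))"
    by (simp add: compactin_PiE)
  ultimately show ?thesis
    by (metis compactin_euclidean_iff euclidean_product_topology)
qed

text \<open>For \<open>x <= M\<close> only the cap \<open>K\<close> matters, and \<open>K\<close>
  dominates every segment line on the interval from 0 to \<open>M\<close>. For \<open>x > M\<close>,
  moving down to \<open>M\<close> does not raise a line of nonnegative slope, while a line of
  negative slope is already nonpositive at \<open>M\<close>.\<close>

lemma penalty_truncation:
  fixes a b :: "'i \<Rightarrow> real"
  assumes "finite N"
  obtains M K where "s \<le> M" "0 \<le> M" "0 \<le> K"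
    "\<And>x y i. \<lbrakk>0 \<le> x; 0 \<le> y; i \<in> N; a i * x - b i \<le> y\<rbrakk> \<Longrightarrow> a i * min x M - b i \<le> min y K"
proof -
  \<comment> \<open>\<open>b i / a i\<close> is the zero of segment \<open>i\<close>, so
    \<open>M\<close> lies at or beyond every such zero; a zero slope contributes 0, the default
    value of division by zero.\<close>
  define M where "M = \<bar>s\<bar> + (\<Sum>i\<in>N. \<bar>b i / a i\<bar>)"
  define K where "K = (\<Sum>i\<in>N. \<bar>a i\<bar> * M + \<bar>b i\<bar>)"
  have "0 \<le> (\<Sum>i\<in>N. \<bar>b i / a i\<bar>)" by (simp add: sum_nonneg)
  then have M: "s \<le> M" "0 \<le> M" by (auto simp: M_def)
  have K: "0 \<le> K" unfolding K_def using M by (intro sum_nonneg) auto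
  have "a i * min x M - b i \<le> min y K"
    if x: "0 \<le> x" and y: "0 \<le> y" and i: "i \<in> N" and le: "a i * x - b i \<le> y" for x y i
  proof -
    have "a i * min x M \<le> \<bar>a i\<bar> * M"
      using M x by (intro mult_mono) auto
    moreover have "\<bar>a i\<bar> * M + \<bar>b i\<bar> \<le> K"
      unfolding K_def using i assms M by (intro member_le_sum) auto
    ultimately have "a i * min x M - b i \<le> K" by linarith
    moreover have "a i * min x M - b i \<le> y"
    proof (cases "x \<le> M")
      case False
      show ?thesis
      proof (cases "a i < 0")
        case True
        have "\<bar>b i / a i\<bar> \<le> (\<Sum>i\<in>N. \<bar>b i / a i\<bar>)"
          using i assms by (intro member_le_sum) auto
        then have "b i / a i \<le> M" unfolding M_def by linarith
        then have "a i * M \<le> b i" using True by (simp add: field_simps)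
        then show ?thesis using False y by simp
      next
        case nonneg: False
        then have "a i * M \<le> a i * x" using False by (intro mult_left_mono) auto
        then show ?thesis using False le by simp
      qed
    qed (use le in simp)
    ultimately show ?thesis by simp
  qed
  with M K that show ?thesis by blast
qed

section \<open>Feasible points of a single chain program\<close>

definition chain_cost ::
  "('p, 'c, 'i) mts_data \<Rightarrow> 'p \<Rightarrow> 'c \<Rightarrow> (nat \<Rightarrow> real) \<Rightarrow> (nat \<Rightarrow> real) \<Rightarrow> real" where
  "chain_cost D p c l psi = (\<Sum>t\<in>periods D. lost_cost D p c * l t + psi t)"

lemma chain_feasible_cong:
  assumes "\<And>t. t \<in> periods D \<Longrightarrow> Ipos t = Ipos' t" "\<And>t. t \<in> periods D \<Longrightarrow> l t = l' t"
    "\<And>t. t \<in> periods D \<Longrightarrow> Ineg t = Ineg' t" "\<And>t. t \<in> periods D \<Longrightarrow> psi t = psi' t"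
  shows "chain_feasible D p c S Ipos l Ineg psi \<longleftrightarrow> chain_feasible D p c S Ipos' l' Ineg' psi'"
proof -
  \<comment> \<open>The only shifted index is \<open>t - 1\<close>, and the guard
    \<open>t > 1\<close> keeps it inside \<open>periods D\<close>.\<close>
  have "Ipos (t - 1) = Ipos' (t - 1)" if "t \<in> periods D" "t > 1" for t
    using that by (intro assms) (auto simp: periods_def)
  then show ?thesis unfolding chain_feasible_def using assms by (simp cong: ball_cong)
qed

text \<open>Lost sales never exceed demand, so inventory grows in each period by at most the supply.
  This supplies the upper bound on inventory that compactness requires.\<close>

lemma chain_inventory_le:
  assumes "chain_feasible D p c S Ipos l Ineg psi" and "t \<in> periods D"
  shows "Ipos t \<le> init_inv D p c + (\<Sum>s=1..t. S s)"
  using assms(2)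
proof (induction t)
  case 0
  then show ?case by (simp add: periods_def)
next
  case (Suc t)
  have l: "l (Suc t) \<le> demand D p c (Suc t)"
    using assms(1) Suc.prems by (auto simp: chain_feasible_def)
  show ?case
  proof (cases "t = 0")
    case True
    then show ?thesis using assms(1) Suc.prems l by (auto simp: chain_feasible_def)
  next
    case False
    then have "Ipos t \<le> init_inv D p c + (\<Sum>s=1..t. S s)"
      using Suc by (auto simp: periods_def)
    moreover have "Ipos (Suc t) - Ipos t - l (Suc t) = S (Suc t) - demand D p c (Suc t)"
      using assms(1) Suc.prems False by (force simp: chain_feasible_def)
    ultimately show ?thesis using l by simp
  qed
qed

lemma chain_feasible_exists:
  assumes "finite (segments D)" and "init_inv D p c \<ge> 0"
    and "\<And>t. t \<in> periods D \<Longrightarrow> demand D p c t \<ge> 0"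
    and "\<And>t. t \<in> periods D \<Longrightarrow> S t \<ge> 0"
  shows "\<exists>Ipos l Ineg psi. chain_feasible D p c S Ipos l Ineg psi"
proof -
  \<comment> \<open>Greedy service: as much demand as possible is served and the rest of the stock
    is carried on. Index 0 holds the initial inventory, so the balance of period 1 becomes an
    instance of the general one.\<close>
  define Ipos where "Ipos = rec_nat (init_inv D p c)
    (\<lambda>t I. max 0 (I + S (Suc t) - demand D p c (Suc t)))"
  have Ipos_0: "Ipos 0 = init_inv D p c"
    and Ipos_Suc: "Ipos (Suc t) = max 0 (Ipos t + S (Suc t) - demand D p c (Suc t))" for t
    by (simp_all add: Ipos_def)
  have Ipos_nonneg: "0 \<le> Ipos t" for t
    using assms(2) by (cases t) (simp_all add: Ipos_0 Ipos_Suc)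
  \<comment> \<open>Solving the balance for lost sales gives, in each period,
    \<open>max 0 (d - I - S)\<close> with \<open>I\<close> the incoming stock. This is at most the
    demand \<open>d\<close> because \<open>d\<close>, \<open>I\<close> and \<open>S\<close> are
    nonnegative.\<close>
  define l where "l t = Ipos t - Ipos (t - 1) - S t + demand D p c t" for t
  define Ineg where "Ineg t = \<bar>safety_stock D p c t\<bar>" for t
  \<comment> \<open>A sum of absolute values dominates each summand, so it meets all penalty bounds
    at once.\<close>
  define psi where "psi t =
    (\<Sum>i\<in>segments D. \<bar>pen_slope D p c t i * Ineg t - pen_offset D p c t i\<bar>)" for t
  have "0 \<le> l t \<and> l t \<le> demand D p c t" if "t \<in> periods D" for t
  proof -
    from that obtain u where u: "t = Suc u" by (cases t) (auto simp: periods_def)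
    show ?thesis
      using assms(3,4)[OF that] Ipos_nonneg[of u] by (simp add: u l_def Ipos_Suc max_def)
  qed
  moreover have "pen_slope D p c t i * Ineg t - pen_offset D p c t i \<le> psi t"
    if "i \<in> segments D" for t i
  proof -
    have "\<bar>pen_slope D p c t i * Ineg t - pen_offset D p c t i\<bar> \<le> psi t"
      unfolding psi_def using that assms(1) by (intro member_le_sum) auto
    then show ?thesis by linarith
  qed
  moreover have "safety_stock D p c t \<le> Ineg t + Ipos t" for t
    using Ipos_nonneg[of t] by (simp add: Ineg_def)
  moreover have "0 \<le> psi t" for t
    unfolding psi_def by (simp add: sum_nonneg)
  moreover have "Ipos 1 - l 1 = init_inv D p c + S 1 - demand D p c 1"
    and "Ipos t - Ipos (t - 1) - l t = S t - demand D p c t" for t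
    by (simp_all add: l_def Ipos_0)
  moreover have "0 \<le> Ineg t" for t
    by (simp add: Ineg_def)
  ultimately have "chain_feasible D p c S Ipos l Ineg psi"
    unfolding chain_feasible_def using Ipos_nonneg by blast
  then show ?thesis by blast
qed

section \<open>Attainment of the chain minimum\<close>

lemma continuous_on_coordinate_comp [continuous_intros]:
  fixes f :: "'b::topological_space \<Rightarrow> 'a \<Rightarrow> 'd::topological_space"
  assumes "continuous_on X f"
  shows "continuous_on X (\<lambda>x. f x t)"
  using assms by (rule continuous_on_product_then_coordinatewise)

lemma closed_chain_feasible:
  "closed {(Ipos, l, Ineg, psi). chain_feasible D p c S Ipos l Ineg psi}"
  unfolding chain_feasible_def case_prod_unfold Ball_def
  \<comment> \<open>The guards of the implications do not mention the variables, so each defines a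
    constant condition, whose set is open, as \<open>closed_Collect_imp\<close> asks.\<close>
  by (intro closed_Collect_conj closed_Collect_all closed_Collect_imp closed_Collect_le
      closed_Collect_eq continuous_intros open_Collect_const)

lemma chain_optimum_exists:
  assumes "finite (segments D)" and "init_inv D p c \<ge> 0"
    and "\<And>t. t \<in> periods D \<Longrightarrow> demand D p c t \<ge> 0"
    and "\<And>t. t \<in> periods D \<Longrightarrow> S t \<ge> 0"
  obtains Ipos l Ineg psi where "chain_feasible D p c S Ipos l Ineg psi"
    and "\<And>Ipos' l' Ineg' psi'. chain_feasible D p c S Ipos' l' Ineg' psi' \<Longrightarrow>
      chain_cost D p c l psi \<le> chain_cost D p c l' psi'"
proof -
  have "\<exists>M K. safety_stock D p c t \<le> M \<and> 0 \<le> M \<and> 0 \<le> K \<and>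
    (\<forall>x y i. 0 \<le> x \<longrightarrow> 0 \<le> y \<longrightarrow> i \<in> segments D \<longrightarrow>
      pen_slope D p c t i * x - pen_offset D p c t i \<le> y \<longrightarrow>
      pen_slope D p c t i * min x M - pen_offset D p c t i \<le> min y K)" for t
    by (rule penalty_truncation[OF assms(1), of "safety_stock D p c t" "pen_slope D p c t"
          "pen_offset D p c t"]) blast
  then obtain M K where M: "\<And>t. safety_stock D p c t \<le> M t" "\<And>t. 0 \<le> M t"
    and K: "\<And>t. 0 \<le> K t"
    and trunc: "\<And>t x y i. \<lbrakk>0 \<le> x; 0 \<le> y; i \<in> segments D;
      pen_slope D p c t i * x - pen_offset D p c t i \<le> y\<rbrakk> \<Longrightarrow>
      pen_slope D p c t i * min x (M t) - pen_offset D p c t i \<le> min y (K t)"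
    by metis
  \<comment> \<open>Outside the horizon the interval collapses to 0: values there are unconstrained,
    and bounds such as \<open>demand\<close> carry no sign there.\<close>
  define box where "box B = {f. \<forall>t. f t \<in> {0..if t \<in> periods D then B t else 0 :: real}}" for B
  define X where "X = (box (\<lambda>t. init_inv D p c + (\<Sum>s=1..t. S s)) \<times> box (demand D p c) \<times>
    box M \<times> box K) \<inter> {(Ipos, l, Ineg, psi). chain_feasible D p c S Ipos l Ineg psi}"
  have "compact X"
    unfolding X_def box_def
    by (intro compact_Int_closed closed_chain_feasible compact_Times compact_function_box)
  \<comment> \<open>This makes a minimum over \<open>X\<close> a minimum over all feasible points.
    Only \<open>Ineg\<close> and \<open>psi\<close> are truncated, since feasibility bounds
    \<open>Ipos\<close> and \<open>l\<close>; the cost ignores \<open>Ineg\<close> and increases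
    with \<open>psi\<close>. Setting values outside the horizon to 0 affects neither feasibility nor
    cost.\<close>
  have reduce: "\<exists>Ipos' l' Ineg' psi'. (Ipos', l', Ineg', psi') \<in> X \<and>
      chain_cost D p c l' psi' \<le> chain_cost D p c l psi"
    if feas: "chain_feasible D p c S Ipos l Ineg psi" for Ipos l Ineg psi
  proof -
    define cut where "cut f t = (if t \<in> periods D then f t else 0 :: real)" for f and t :: nat
    define Ineg' where "Ineg' t = min (Ineg t) (M t)" for t
    define psi' where "psi' t = min (psi t) (K t)" for t
    have "safety_stock D p c t \<le> Ineg' t + Ipos t" if "t \<in> periods D" for t
      using feas that M(1)[of t] by (force simp: chain_feasible_def Ineg'_def min_def)
    moreover have "pen_slope D p c t i * Ineg' t - pen_offset D p c t i \<le> psi' t"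
      if "t \<in> periods D" "i \<in> segments D" for t i
      unfolding Ineg'_def psi'_def
      using feas that by (intro trunc) (auto simp: chain_feasible_def)
    ultimately have feas': "chain_feasible D p c S Ipos l Ineg' psi'"
      using feas M(2) K by (simp add: chain_feasible_def) (simp add: Ineg'_def psi'_def)
    then have "chain_feasible D p c S (cut Ipos) (cut l) (cut Ineg') (cut psi')"
      by (subst chain_feasible_cong[of _ _ Ipos _ l _ Ineg' _ psi']) (simp_all add: cut_def)
    moreover have "cut Ipos \<in> box (\<lambda>t. init_inv D p c + (\<Sum>s=1..t. S s))"
      using feas chain_inventory_le[OF feas] by (auto simp: box_def cut_def chain_feasible_def)
    moreover have "cut l \<in> box (demand D p c)"
      using feas by (auto simp: box_def cut_def chain_feasible_def)
    moreover have "cut Ineg' \<in> box M" "cut psi' \<in> box K"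
      using feas' by (auto simp: box_def cut_def chain_feasible_def Ineg'_def psi'_def)
    moreover have "chain_cost D p c (cut l) (cut psi') \<le> chain_cost D p c l psi"
      unfolding chain_cost_def by (intro sum_mono) (simp add: cut_def psi'_def)
    ultimately show ?thesis unfolding X_def by blast
  qed
  have "X \<noteq> {}" using chain_feasible_exists[where S = S, OF assms] reduce by blast
  moreover have "continuous_on X (\<lambda>(Ipos, l, Ineg, psi). chain_cost D p c l psi)"
    unfolding chain_cost_def case_prod_unfold by (intro continuous_intros)
  ultimately obtain x where "x \<in> X"
    and "\<forall>y\<in>X. (\<lambda>(Ipos, l, Ineg, psi). chain_cost D p c l psi) x
      \<le> (\<lambda>(Ipos, l, Ineg, psi). chain_cost D p c l psi) y"
    using continuous_attains_inf[OF \<open>compact X\<close>] by blast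
  moreover obtain Ipos l Ineg psi where "x = (Ipos, l, Ineg, psi)" by (cases x)
  ultimately have opt: "(Ipos, l, Ineg, psi) \<in> X"
    "\<And>Ipos' l' Ineg' psi'. (Ipos', l', Ineg', psi') \<in> X \<Longrightarrow>
      chain_cost D p c l psi \<le> chain_cost D p c l' psi'"
    by auto
  show ?thesis
  proof
    show "chain_feasible D p c S Ipos l Ineg psi" using opt(1) by (simp add: X_def)
    show "chain_cost D p c l psi \<le> chain_cost D p c l' psi'"
      if "chain_feasible D p c S Ipos' l' Ineg' psi'" for Ipos' l' Ineg' psi'
      using reduce[OF that] opt(2) by (meson order_trans)
  qed
qed

text \<open>\<open>LEAST\<close> on the reals carries information only once a least value is known
  to exist; the attained optimum provides it.\<close>

lemma Z_chain_optimum: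
  assumes "finite (segments D)" and "init_inv D p c \<ge> 0"
    and "\<And>t. t \<in> periods D \<Longrightarrow> demand D p c t \<ge> 0"
    and "\<And>t. t \<in> periods D \<Longrightarrow> S t \<ge> 0"
  shows Z_chain_attained: "\<exists>Ipos l Ineg psi. chain_feasible D p c S Ipos l Ineg psi \<and>
      Z_chain D p c S = chain_cost D p c l psi"
    and Z_chain_le: "chain_feasible D p c S Ipos' l' Ineg' psi' \<Longrightarrow>
      Z_chain D p c S \<le> chain_cost D p c l' psi'"
proof -
  obtain Ipos l Ineg psi where opt: "chain_feasible D p c S Ipos l Ineg psi"
    "\<And>Ipos' l' Ineg' psi'. chain_feasible D p c S Ipos' l' Ineg' psi' \<Longrightarrow>
      chain_cost D p c l psi \<le> chain_cost D p c l' psi'"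
    using chain_optimum_exists[where S = S, OF assms] by blast
  have Z: "Z_chain D p c S = chain_cost D p c l psi"
    unfolding Z_chain_def chain_cost_def[symmetric]
    by (rule Least_equality) (use opt in blast)+
  show "\<exists>Ipos l Ineg psi. chain_feasible D p c S Ipos l Ineg psi \<and>
      Z_chain D p c S = chain_cost D p c l psi"
    using opt(1) Z by blast
  show "Z_chain D p c S \<le> chain_cost D p c l' psi'"
    if "chain_feasible D p c S Ipos' l' Ineg' psi'"
    using opt(2)[OF that] Z by simp
qed

section \<open>Separation of the joint minimum\<close>

theorem proposition1:
  fixes D :: "('p, 'c, 'i) mts_data"
    and S :: "'p \<Rightarrow> 'c \<Rightarrow> nat \<Rightarrow> real"
  assumes "finite (products D)" and "finite (customers D)" and "finite (segments D)"
    and "\<And>p c t. \<lbrakk>p \<in> products D; c \<in> customers D; t \<in> periods D\<rbrakk> \<Longrightarrow> demand D p c t \<ge> 0"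
    and "\<And>p c. \<lbrakk>p \<in> products D; c \<in> customers D\<rbrakk> \<Longrightarrow> init_inv D p c \<ge> 0"
    and "\<And>p c t. \<lbrakk>p \<in> products D; c \<in> customers D; t \<in> periods D\<rbrakk> \<Longrightarrow> safety_stock D p c t \<ge> 0"
    and "\<And>p c. \<lbrakk>p \<in> products D; c \<in> customers D\<rbrakk> \<Longrightarrow> lost_cost D p c \<ge> 0"
    and "\<And>p c t. \<lbrakk>p \<in> products D; c \<in> customers D; t \<in> periods D\<rbrakk> \<Longrightarrow> S p c t \<ge> 0"
  shows "Z_MTS D S = (\<Sum>p\<in>products D. \<Sum>c\<in>customers D. Z_chain D p c (S p c))"
proof -
  \<comment> \<open>Membership sits inside the existential so that choice over all \<open>p\<close>
    and \<open>c\<close> yields total functions.\<close>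
  have "\<exists>Ipos l Ineg psi. p \<in> products D \<longrightarrow> c \<in> customers D \<longrightarrow>
      chain_feasible D p c (S p c) Ipos l Ineg psi \<and>
      Z_chain D p c (S p c) = chain_cost D p c l psi" for p c
    using Z_chain_attained[of D p c "S p c"] assms(3,4,5,8) by blast
  then obtain Ipos l Ineg psi where opt: "\<And>p c. p \<in> products D \<Longrightarrow> c \<in> customers D \<Longrightarrow>
      chain_feasible D p c (S p c) (Ipos p c) (l p c) (Ineg p c) (psi p c) \<and>
      Z_chain D p c (S p c) = chain_cost D p c (l p c) (psi p c)"
    by metis
  show ?thesis
    unfolding Z_MTS_def chain_cost_def[symmetric]
  proof (rule Least_equality)
    \<comment> \<open>No constraint links two pairs, so optimal chain solutions placed side by side
      form a joint solution.\<close>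
    have "joint_feasible D S Ipos l Ineg psi"
      using opt by (simp add: joint_feasible_def)
    moreover have "(\<Sum>p\<in>products D. \<Sum>c\<in>customers D. Z_chain D p c (S p c)) =
        (\<Sum>p\<in>products D. \<Sum>c\<in>customers D. chain_cost D p c (l p c) (psi p c))"
      using opt by (intro sum.cong) auto
    ultimately show "\<exists>Ipos l Ineg psi. joint_feasible D S Ipos l Ineg psi \<and>
        (\<Sum>p\<in>products D. \<Sum>c\<in>customers D. Z_chain D p c (S p c)) =
        (\<Sum>p\<in>products D. \<Sum>c\<in>customers D. chain_cost D p c (l p c) (psi p c))"
      by blast
  next
    fix z
    assume "\<exists>Ipos l Ineg psi. joint_feasible D S Ipos l Ineg psi \<and>
        z = (\<Sum>p\<in>products D. \<Sum>c\<in>customers D. chain_cost D p c (l p c) (psi p c))"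
    then obtain Ipos l Ineg psi where feas: "joint_feasible D S Ipos l Ineg psi"
      and z: "z = (\<Sum>p\<in>products D. \<Sum>c\<in>customers D. chain_cost D p c (l p c) (psi p c))"
      by blast
    \<comment> \<open>Each component of a joint solution is feasible for its own chain, hence costs
      at least that chain's minimum.\<close>
    show "(\<Sum>p\<in>products D. \<Sum>c\<in>customers D. Z_chain D p c (S p c)) \<le> z"
      unfolding z
    proof (intro sum_mono)
      fix p c
      assume "p \<in> products D" "c \<in> customers D"
      then show "Z_chain D p c (S p c) \<le> chain_cost D p c (l p c) (psi p c)"
        using feas assms(3,4,5,8) by (intro Z_chain_le) (auto simp: joint_feasible_def)
    qed
  qed
qed

end
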